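(* Let $\mathcal{E}$ be a consumption-loan overlapping generations economy (as described in the context) which has bounded intraperiod growth rates with constants $0<\alpha_{\min}<\alpha_{\max}$, has unbounded aggregate demand at border prices with constants $\sigma_t\in(0,1)$, $t\ge0$, satisfies the generalized Cass criterion, and is prone to savings. Let $p\in\mathcal{H}$. Then $p\notin\mathcal{H}^{PO}$ if, and only if, $$\lim_{t\to\infty}\frac{\sum_{h\in G_t}s^h(p_t,p_{t+1})}{\sum_{h\in G_t}\Vert e^h_t\Vert}=0.$$
   Context: Notation: $\Vert c\Vert=\sum_i|c_i|$; $\mathbb{R}_+^n$, $\mathbb{R}_{++}^n$ are the vectors with non-negative, resp. strictly positive, coordinates; elements of $\mathbb{R}^\infty$ are written $p=(p_0,p_1,\ldots)$ with $p_t\in\mathbb{R}^{L_t}$, $p_t=(p_{t1},\ldots,p_{tL_t})$. Vectors in $\mathbb{R}^{L_t+L_{t+1}}$ are regarded as elements of $\mathbb{R}^\infty$ by placing them in the coordinates of periods $t,t+1$ and $0$ elsewhere. Economy $\mathcal{E}$: time is $t\in\{0,1,2,\ldots\}$, with $L_t\ge1$ perishable commodities in period $t$. Households are indexed by $h\in\mathbb{N}$; $G_t$ is the (finite, non-empty) set of households born in period $t\ge0$; each lives in periods $t$ and $t+1$. Household $h\in G_t$ has consumption set $\mathbb{R}^{L_t+L_{t+1}}_+$, a nonzero endowment $e^h=(e^h_t,e^h_{t+1})\in\mathbb{R}^{L_t+L_{t+1}}_+$ and a utility function $u^h:\mathbb{R}^{L_t+L_{t+1}}_+\to\mathbb{R}$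 that is continuous, non-decreasing, without local maxima and semi-strictly quasiconcave (i.e. $u(\tilde c)\ge u(c)$ implies $u(\alpha\tilde c+(1-\alpha)c)\ge u(c)$ for $0\le\alpha\le1$, and $u(\tilde c)>u(c)$ implies $u(\alpha\tilde c+(1-\alpha)c)>u(c)$ for $0<\alpha\le1$). Also $\sum_{t\ge0}\sum_{h\in G_t}e^h\in\mathbb{R}^\infty_{++}$. Demand: for $h\in G_t$ and $(p_t,p_{t+1})\in\mathbb{R}^{L_t+L_{t+1}}_{++}$, $x^h(p_t,p_{t+1})=(x^h_t,x^h_{t+1})(p_t,p_{t+1})$ is the maximizer of $u^h(c)$ over $c\in\mathbb{R}_+^{L_t+L_{t+1}}$ with $(p_t,p_{t+1})\cdot(c-e^h)\le0$; it is assumed to be single-valued, so $x^h$ is a function. Excess demand in period $t\ge1$ is $$z_t(p_{t-1},p_t,p_{t+1})=\sum_{h\in G_{t-1}}(x^h_t(p_{t-1},p_t)-e^h_t)+\sum_{h\in G_t}(x^h_t(p_t,p_{t+1})-e^h_t).$$ Real savings of $h\in G_t$: $s^h(p_t,p_{t+1})=\frac{p_t}{\Vert p_t\Vert}\cdot(e^h_t-x^h_t(p_t,p_{t+1}))$. Bounded intraperiod growth rates: there are $0<\alpha_{\min}<\alpha_{\max}$ such that $\alpha_t=\sum_{h\in G_{t+1}}\Vert e^h_{t+1}\Vert/\sum_{h\in G_t}\Vert e^h_{t+1}\Vert\in(\alpha_{\min},\alpha_{\max})$ for all $t\ge0$. Put $\beta=\max\{1+\alpha_{\min}^{-1},1+\alpha_{\max}\}$.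 Unbounded aggregate demand at border prices: with $\mathcal{B}_t(\sigma)=\{p\in\mathbb{R}^{L_t+L_{t+1}}_{++}\mid\sigma\le p_i\le\sigma^{-1},\ 1\le i\le L_t+L_{t+1}\}$, for all $t\ge0$ there is $\sigma_t\in(0,1)$ (fixed from now on) such that for all $(p_t,p_{t+1})\in\mathbb{R}^{L_t+L_{t+1}}_{++}$, if $(p_t/p_{t1},p_{t+1}/p_{t1})\notin\mathcal{B}_t(\sigma_t)$ then $\sum_{h\in G_t}\Vert x^h(p_t,p_{t+1})\Vert>\beta\sum_{h\in G_t}\Vert e^h\Vert$. Set of equilibria: $\mathcal{H}=\{p\in\mathbb{R}^{\infty}_{++}\mid p_{01}=1,\ (p_0,p_1)\in\mathcal{B}_0(\sigma_0),\ z_t(p_{t-1},p_t,p_{t+1})=0\ \forall t\ge1\}$. Subset of Pareto optimal equilibria: $\mathcal{H}^{PO}$ is the set of $p\in\mathcal{H}$ for which there is no family $\{y^h\}$, $y^h\in\mathbb{R}^{L_t+L_{t+1}}_+$ for $h\in G_t$, $t\ge0$, with $\sum_{t\ge0}\sum_{h\in G_t}(y^h-x^h(p_t,p_{t+1}))=0$ and $u^h(y^h)\ge u^h(x^h(p_t,p_{t+1}))$ for all $h\in G_t$, $t\ge0$, with at least one strict inequality. Generalized Cass criterion (an assumption on $\mathcal{E}$): for every $p\in\mathcal{H}$, $p\in\mathcal{H}^{PO}$ if and only if $\sum_{t=0}^{\infty}\frac{1}{\Vert p_t\Vert\sum_{h\in G_t}\Vert e^h_t\Vert}=+\infty$. Prone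 to savings: there are $\varepsilon>0$, $\delta>0$ such that for all $t\ge0$ and $(p_t,p_{t+1})\in\mathbb{R}^{L_t+L_{t+1}}_{++}$ with $(p_t/p_{t1},p_{t+1}/p_{t1})\in\mathcal{B}_t(\sigma_t)$, $$\frac{\sum_{h\in G_t}s^h(p_t,p_{t+1})}{\sum_{h\in G_t}\Vert e^h_t\Vert}\le\delta\implies\frac{\Vert p_t\Vert}{\Vert p_{t+1}\Vert}\le\frac{1}{1+\varepsilon}\,\frac{\sum_{h\in G_{t+1}}\Vert e^h_{t+1}\Vert}{\sum_{h\in G_t}\Vert e^h_t\Vert}.$$ *)

theory Defs
  imports "HOL-Analysis.Analysis"
begin

text \<open>
  An element \<open>c\<close> of \<open>R^\<infinity>\<close> is a function of a period \<open>s\<close> and a commodity \<open>i \<in> {1..L s}\<close> that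
  vanishes at all other pairs \<open>(s, i)\<close>.  Finite-dimensional vectors such as those in
  \<open>R^(L t + L (t+1))\<close> are the elements of \<open>R^\<infinity>\<close> that vanish outside the periods \<open>t\<close>, \<open>t + 1\<close>.
\<close>

type_synonym vec = "nat \<Rightarrow> nat \<Rightarrow> real"

record economy =
  goods :: "nat \<Rightarrow> nat"
  born :: "nat \<Rightarrow> nat set"
  endow :: "nat \<Rightarrow> vec"
  util :: "nat \<Rightarrow> vec \<Rightarrow> real"

text \<open>In the following, \<open>T\<close> is the set of periods to which the vectors belong.\<close>

definition vecs :: "economy \<Rightarrow> nat set \<Rightarrow> vec set" where
  "vecs E T = {c. \<forall>s i. \<not> (s \<in> T \<and> i \<in> {1..goods E s}) \<longrightarrow> c s i = 0}"

definition nonneg_vecs :: "economy \<Rightarrow> nat set \<Rightarrow> vec set" where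
  "nonneg_vecs E T = {c \<in> vecs E T. \<forall>s\<in>T. \<forall>i\<in>{1..goods E s}. 0 \<le> c s i}"

definition pos_vecs :: "economy \<Rightarrow> nat set \<Rightarrow> vec set" where
  "pos_vecs E T = {c \<in> vecs E T. \<forall>s\<in>T. \<forall>i\<in>{1..goods E s}. 0 < c s i}"

definition norm1 :: "economy \<Rightarrow> nat set \<Rightarrow> vec \<Rightarrow> real" where
  "norm1 E T c = (\<Sum>s\<in>T. \<Sum>i\<in>{1..goods E s}. \<bar>c s i\<bar>)"

definition window :: "nat \<Rightarrow> vec \<Rightarrow> vec" where
  "window t p = (\<lambda>s i. if s \<in> {t, t + 1} then p s i else 0)"

abbreviation consumption_set :: "economy \<Rightarrow> nat \<Rightarrow> vec set" where
  "consumption_set E t \<equiv> nonneg_vecs E {t, t + 1}"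

definition mix :: "real \<Rightarrow> vec \<Rightarrow> vec \<Rightarrow> vec" where
  "mix a c' c = (\<lambda>s i. a * c' s i + (1 - a) * c s i)"

definition nondecreasing_on :: "vec set \<Rightarrow> (vec \<Rightarrow> real) \<Rightarrow> bool" where
  "nondecreasing_on C u \<longleftrightarrow> (\<forall>c\<in>C. \<forall>c'\<in>C. (\<forall>s i. c s i \<le> c' s i) \<longrightarrow> u c \<le> u c')"

definition no_local_max_on :: "vec set \<Rightarrow> (vec \<Rightarrow> real) \<Rightarrow> bool" where
  "no_local_max_on C u \<longleftrightarrow>
     (\<forall>c\<in>C. \<not> (\<exists>U. open U \<and> c \<in> U \<and> (\<forall>c'\<in>C \<inter> U. u c' \<le> u c)))"

definition semistrictly_quasiconcave_on :: "vec set \<Rightarrow> (vec \<Rightarrow> real) \<Rightarrow> bool" where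
  "semistrictly_quasiconcave_on C u \<longleftrightarrow>
     (\<forall>c'\<in>C. \<forall>c\<in>C.
        (u c' \<ge> u c \<longrightarrow> (\<forall>a. 0 \<le> a \<and> a \<le> 1 \<longrightarrow> u (mix a c' c) \<ge> u c)) \<and>
        (u c' > u c \<longrightarrow> (\<forall>a. 0 < a \<and> a \<le> 1 \<longrightarrow> u (mix a c' c) > u c)))"

text \<open>
  In \<open>budget\<close>, \<open>demand\<close>, \<open>excess_demand\<close> and \<open>savings\<close> the price argument \<open>p\<close> may be any element
  of \<open>R^\<infinity>\<close>.  For a household born in period \<open>t\<close> only \<open>p t\<close> and \<open>p (t + 1)\<close> enter the budget
  constraint, so that \<open>demand E t h p\<close> is \<open>x^h(p_t, p_{t+1})\<close>.
\<close>

definition budget :: "economy \<Rightarrow> nat \<Rightarrow> nat \<Rightarrow> vec \<Rightarrow> vec set" where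
  "budget E t h p =
     {c \<in> consumption_set E t.
        (\<Sum>s\<in>{t, t + 1}. \<Sum>i\<in>{1..goods E s}. p s i * (c s i - endow E h s i)) \<le> 0}"

definition is_demand :: "economy \<Rightarrow> nat \<Rightarrow> nat \<Rightarrow> vec \<Rightarrow> vec \<Rightarrow> bool" where
  "is_demand E t h p c \<longleftrightarrow> is_arg_max (util E h) (\<lambda>c. c \<in> budget E t h p) c"

definition demand :: "economy \<Rightarrow> nat \<Rightarrow> nat \<Rightarrow> vec \<Rightarrow> vec" where
  "demand E t h p = (THE c. is_demand E t h p c)"

text \<open>
  The sum over all \<open>t\<close> in the aggregate endowment is, in each coordinate \<open>(s, i)\<close>, a series with
  at most two nonzero terms (\<open>t = s\<close> and \<open>t + 1 = s\<close>).
\<close>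

definition olg_economy :: "economy \<Rightarrow> bool" where
  "olg_economy E \<longleftrightarrow>
     (\<forall>t. goods E t \<ge> 1) \<and>
     (\<forall>t. finite (born E t) \<and> born E t \<noteq> {}) \<and>
     disjoint_family (born E) \<and> (\<Union>t. born E t) = UNIV \<and>
     (\<forall>t. \<forall>h\<in>born E t.
        endow E h \<in> consumption_set E t \<and> endow E h \<noteq> (\<lambda>s i. 0) \<and>
        continuous_on (consumption_set E t) (util E h) \<and>
        nondecreasing_on (consumption_set E t) (util E h) \<and>
        no_local_max_on (consumption_set E t) (util E h) \<and>
        semistrictly_quasiconcave_on (consumption_set E t) (util E h)) \<and>
     (\<lambda>s i. \<Sum>t. \<Sum>h\<in>born E t. endow E h s i) \<in> pos_vecs E UNIV \<and>
     (\<forall>t. \<forall>h\<in>born E t. \<forall>p\<in>pos_vecs E {t, t + 1}. \<exists>!c. is_demand E t h p c)"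

text \<open>Excess demand in period \<open>t\<close> is only meaningful for \<open>t \<ge> 1\<close>.\<close>

definition excess_demand :: "economy \<Rightarrow> nat \<Rightarrow> vec \<Rightarrow> nat \<Rightarrow> real" where
  "excess_demand E t p i =
     (\<Sum>h\<in>born E (t - 1). demand E (t - 1) h p t i - endow E h t i) +
     (\<Sum>h\<in>born E t. demand E t h p t i - endow E h t i)"

definition savings :: "economy \<Rightarrow> nat \<Rightarrow> nat \<Rightarrow> vec \<Rightarrow> real" where
  "savings E t h p =
     (\<Sum>i\<in>{1..goods E t}. p t i / norm1 E {t} p * (endow E h t i - demand E t h p t i))"

definition young_endow :: "economy \<Rightarrow> nat \<Rightarrow> real" where
  "young_endow E t = (\<Sum>h\<in>born E t. norm1 E {t} (endow E h))"

definition old_endow :: "economy \<Rightarrow> nat \<Rightarrow> real" where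
  "old_endow E t = (\<Sum>h\<in>born E t. norm1 E {t + 1} (endow E h))"

definition savings_ratio :: "economy \<Rightarrow> nat \<Rightarrow> vec \<Rightarrow> real" where
  "savings_ratio E t p = (\<Sum>h\<in>born E t. savings E t h p) / young_endow E t"

definition bounded_growth :: "economy \<Rightarrow> real \<Rightarrow> real \<Rightarrow> bool" where
  "bounded_growth E amin amax \<longleftrightarrow>
     0 < amin \<and> amin < amax \<and>
     (\<forall>t. young_endow E (t + 1) / old_endow E t \<in> {amin<..<amax})"

definition beta :: "real \<Rightarrow> real \<Rightarrow> real" where
  "beta amin amax = max (1 + inverse amin) (1 + amax)"

definition box :: "economy \<Rightarrow> nat \<Rightarrow> real \<Rightarrow> vec set" where
  "box E t \<sigma> =
     {p \<in> pos_vecs E {t, t + 1}.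
        \<forall>s\<in>{t, t + 1}. \<forall>i\<in>{1..goods E s}. \<sigma> \<le> p s i \<and> p s i \<le> inverse \<sigma>}"

definition normalize_price :: "nat \<Rightarrow> vec \<Rightarrow> vec" where
  "normalize_price t p = (\<lambda>s i. p s i / p t 1)"

definition unbounded_demand :: "economy \<Rightarrow> real \<Rightarrow> real \<Rightarrow> (nat \<Rightarrow> real) \<Rightarrow> bool" where
  "unbounded_demand E amin amax \<sigma> \<longleftrightarrow>
     (\<forall>t. 0 < \<sigma> t \<and> \<sigma> t < 1 \<and>
       (\<forall>p\<in>pos_vecs E {t, t + 1}.
          normalize_price t p \<notin> box E t (\<sigma> t) \<longrightarrow>
          (\<Sum>h\<in>born E t. norm1 E {t, t + 1} (demand E t h p))
            > beta amin amax * (\<Sum>h\<in>born E t. norm1 E {t, t + 1} (endow E h))))"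

definition equilibria :: "economy \<Rightarrow> (nat \<Rightarrow> real) \<Rightarrow> vec set" where
  "equilibria E \<sigma> =
     {p \<in> pos_vecs E UNIV.
        p 0 1 = 1 \<and> window 0 p \<in> box E 0 (\<sigma> 0) \<and>
        (\<forall>t\<ge>1. \<forall>i\<in>{1..goods E t}. excess_demand E t p i = 0)}"

text \<open>
  As for the aggregate endowment, each coordinate of the feasibility condition is a series with at
  most two nonzero terms.
\<close>

definition pareto_improvement :: "economy \<Rightarrow> vec \<Rightarrow> (nat \<Rightarrow> vec) \<Rightarrow> bool" where
  "pareto_improvement E p y \<longleftrightarrow>
     (\<forall>t. \<forall>h\<in>born E t. y h \<in> consumption_set E t) \<and>
     (\<forall>s i. (\<Sum>t. \<Sum>h\<in>born E t. y h s i - demand E t h p s i) = 0) \<and>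
     (\<forall>t. \<forall>h\<in>born E t. util E h (y h) \<ge> util E h (demand E t h p)) \<and>
     (\<exists>t. \<exists>h\<in>born E t. util E h (y h) > util E h (demand E t h p))"

definition po_equilibria :: "economy \<Rightarrow> (nat \<Rightarrow> real) \<Rightarrow> vec set" where
  "po_equilibria E \<sigma> = {p \<in> equilibria E \<sigma>. \<not> (\<exists>y. pareto_improvement E p y)}"

definition generalized_cass :: "economy \<Rightarrow> (nat \<Rightarrow> real) \<Rightarrow> bool" where
  "generalized_cass E \<sigma> \<longleftrightarrow>
     (\<forall>p\<in>equilibria E \<sigma>.
        p \<in> po_equilibria E \<sigma> \<longleftrightarrow>
        filterlim (\<lambda>n. \<Sum>t\<le>n. 1 / (norm1 E {t} p * young_endow E t)) at_top sequentially)"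

definition prone_to_savings :: "economy \<Rightarrow> (nat \<Rightarrow> real) \<Rightarrow> bool" where
  "prone_to_savings E \<sigma> \<longleftrightarrow>
     (\<exists>\<epsilon> \<delta>. \<epsilon> > 0 \<and> \<delta> > 0 \<and>
       (\<forall>t. \<forall>p\<in>pos_vecs E {t, t + 1}.
          normalize_price t p \<in> box E t (\<sigma> t) \<longrightarrow>
          savings_ratio E t p \<le> \<delta> \<longrightarrow>
          norm1 E {t} p / norm1 E {t + 1} p
            \<le> 1 / (1 + \<epsilon>) * (young_endow E (t + 1) / young_endow E t)))"

end

theory Submission
  imports Defs
begin

text \<open>
  By Walras' law the value of aggregate savings \<open>p\<^sub>t \<cdot> (e\<^sub>t - x\<^sub>t)\<close> of generation \<open>t\<close> is what the
  generation dissaves in \<open>t + 1\<close>, and by market clearing this is what generation \<open>t + 1\<close> saves.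
  Hence it is a constant \<open>M\<close>, and the savings ratio in period \<open>t\<close> is \<open>M\<close> times the \<open>t\<close>-th term of
  the Cass series.  If the equilibrium is not Pareto optimal, then the series converges and its
  terms tend to \<open>0\<close>.  Conversely, market clearing keeps equilibrium prices away from the border, so
  if the savings ratio tends to \<open>0\<close>, then proneness to savings eventually applies in every period
  and says that the terms of the series decrease geometrically.
\<close>

section \<open>Restricting prices to the two periods of a lifetime\<close>

lemma window_apply:
  "s = t \<or> s = t + 1 \<Longrightarrow> window t p s = p s"
  by (auto simp: window_def)

text \<open>The assumptions on demand and savings quantify over prices that vanish outside
  \<open>t\<close> and \<open>t + 1\<close>. An equilibrium price has to be cut down to such a
  window before they apply to it; the neighbouring lemmas carry the conclusions back.\<close>

lemma window_pos_vecs: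
  assumes "p \<in> pos_vecs E UNIV"
  shows "window t p \<in> pos_vecs E {t, t + 1}"
  using assms by (auto simp: pos_vecs_def vecs_def window_def)

lemma budget_window: "budget E t h (window t p) = budget E t h p"
  by (simp add: budget_def window_apply)

lemma demand_window: "demand E t h (window t p) = demand E t h p"
  by (simp add: demand_def is_demand_def budget_window)

lemma norm1_window:
  "norm1 E {t} (window t p) = norm1 E {t} p"
  "norm1 E {t + 1} (window t p) = norm1 E {t + 1} p"
  by (simp_all add: norm1_def window_apply)

lemma savings_ratio_window: "savings_ratio E t (window t p) = savings_ratio E t p"
  by (simp add: savings_ratio_def savings_def norm1_window demand_window window_apply)

section \<open>Positivity of norms and endowment bounds\<close>

lemma norm1_nonneg: "norm1 E T c \<ge> 0"
  by (simp add: norm1_def sum_nonneg)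

lemma norm1_two_periods: "norm1 E {t, t + 1} c = norm1 E {t} c + norm1 E {t + 1} c"
  by (simp add: norm1_def)

lemma norm1_price_pos:
  assumes "olg_economy E" "p \<in> pos_vecs E UNIV"
  shows "norm1 E {t} p > 0"
proof -
  have "goods E t \<ge> 1" using assms by (auto simp: olg_economy_def)
  then show ?thesis
    using assms(2) unfolding norm1_def pos_vecs_def
    by (auto intro!: sum_pos simp: less_imp_neq[symmetric])
qed

lemma old_endow_nonneg: "old_endow E t \<ge> 0"
  by (simp add: old_endow_def sum_nonneg norm1_nonneg)

lemma young_endow_nonneg: "young_endow E t \<ge> 0"
  by (simp add: young_endow_def sum_nonneg norm1_nonneg)

lemma bounded_growth_bounds:
  assumes "bounded_growth E a b"
  shows "old_endow E t > 0" "young_endow E (t + 1) > 0"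
    "old_endow E t \<le> inverse a * young_endow E (t + 1)"
    "young_endow E (t + 1) \<le> b * old_endow E t"
proof -
  have q: "0 < a" "a < young_endow E (t + 1) / old_endow E t"
    "young_endow E (t + 1) / old_endow E t < b"
    using assms by (auto simp: bounded_growth_def)
  \<comment> \<open>A quotient with denominator 0 is 0, which does not exceed
    \<open>a\<close>.\<close>
  then have "old_endow E t \<noteq> 0" by auto
  with old_endow_nonneg[of E t] show o: "old_endow E t > 0" by linarith
  have le: "a * old_endow E t < young_endow E (t + 1)"
    using q o by (simp add: field_simps)
  with q o show "young_endow E (t + 1) > 0"
    by (smt (verit) mult_pos_pos)
  show "old_endow E t \<le> inverse a * young_endow E (t + 1)"
    using le q by (simp add: field_simps)
  show "young_endow E (t + 1) \<le> b * old_endow E t"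
    using q o by (simp add: field_simps)
qed

section \<open>Individual demand and Walras' law\<close>

lemma demand_is_demand:
  assumes "olg_economy E" "h \<in> born E t" "p \<in> pos_vecs E UNIV"
  shows "is_demand E t h p (demand E t h p)"
proof -
  have "\<exists>!c. is_demand E t h (window t p) c"
    using assms window_pos_vecs[OF assms(3), of t] unfolding olg_economy_def by blast
  then have "\<exists>!c. is_demand E t h p c"
    by (simp add: is_demand_def budget_window)
  then show ?thesis unfolding demand_def by (rule theI')
qed

lemma demand_in_consumption_set:
  assumes "olg_economy E" "h \<in> born E t" "p \<in> pos_vecs E UNIV"
  shows "demand E t h p \<in> consumption_set E t"
  using demand_is_demand[OF assms]
  by (auto simp: is_demand_def is_arg_max_def budget_def)

lemma demand_nonneg:
  assumes "olg_economy E" "h \<in> born E t" "p \<in> pos_vecs E UNIV"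
  shows "demand E t h p s i \<ge> 0"
proof -
  have "demand E t h p \<in> nonneg_vecs E {t, t + 1}"
    by (rule demand_in_consumption_set[OF assms])
  then show ?thesis
    unfolding nonneg_vecs_def vecs_def
    by (cases "s \<in> {t, t + 1} \<and> i \<in> {1..goods E s}") auto
qed

lemma endow_nonneg:
  assumes "olg_economy E" "h \<in> born E t"
  shows "endow E h s i \<ge> 0"
proof -
  have "endow E h \<in> nonneg_vecs E {t, t + 1}"
    using assms unfolding olg_economy_def by blast
  then show ?thesis
    unfolding nonneg_vecs_def vecs_def
    by (cases "s \<in> {t, t + 1} \<and> i \<in> {1..goods E s}") auto
qed

text \<open>If the budget were slack at the demand, continuity of the budget value in the product
  topology would make it slack on an open neighbourhood. All consumption bundles there are
  affordable, so the demand would be a local maximum of utility.\<close>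

lemma walras_law:
  assumes "olg_economy E" "h \<in> born E t" "p \<in> pos_vecs E UNIV"
  shows "(\<Sum>s\<in>{t, t + 1}. \<Sum>i\<in>{1..goods E s}. p s i * (demand E t h p s i - endow E h s i)) = 0"
proof (rule ccontr)
  define v where
    "v c = (\<Sum>s\<in>{t, t + 1}. \<Sum>i\<in>{1..goods E s}. p s i * (c s i - endow E h s i))" for c :: vec
  define d where "d = demand E t h p"
  have d: "d \<in> budget E t h p" "\<And>c. c \<in> budget E t h p \<Longrightarrow> util E h c \<le> util E h d"
    using demand_is_demand[OF assms] by (auto simp: d_def is_demand_def is_arg_max_def not_less)
  assume "\<not> ?thesis"
  then have "v d < 0"
    using d(1) by (auto simp: budget_def v_def d_def)
  have "continuous_on UNIV (\<lambda>c :: vec. c s i)" for s i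
    by (rule continuous_on_product_then_coordinatewise[OF continuous_on_product_coordinates])
  then have "continuous_on UNIV v"
    unfolding v_def by (intro continuous_intros) auto
  then have "open {c. v c < 0}"
    by (intro open_Collect_less continuous_intros)
  moreover have "util E h c \<le> util E h d" if "c \<in> consumption_set E t \<inter> {c. v c < 0}" for c
    using that by (intro d(2)) (auto simp: budget_def v_def)
  moreover have "d \<in> consumption_set E t"
    using d(1) by (simp add: budget_def)
  ultimately have "\<not> no_local_max_on (consumption_set E t) (util E h)"
    using \<open>v d < 0\<close> unfolding no_local_max_on_def by blast
  then show False
    using assms(1,2) unfolding olg_economy_def by blast
qed

section \<open>Constancy of aggregate savings\<close>

text \<open>Prices are not divided by their norm here: only this unnormalized value is passed on
  unchanged from one generation to the next.\<close>

definition savings_value :: "economy \<Rightarrow> vec \<Rightarrow> nat \<Rightarrow> real" where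
  "savings_value E p t =
     (\<Sum>i\<in>{1..goods E t}. \<Sum>h\<in>born E t. p t i * (endow E h t i - demand E t h p t i))"

lemma savings_ratio_eq:
  "savings_ratio E t p = savings_value E p t * (1 / (norm1 E {t} p * young_endow E t))"
proof -
  have "(\<Sum>h\<in>born E t. savings E t h p) = savings_value E p t / norm1 E {t} p"
    unfolding savings_def savings_value_def
    by (subst sum.swap) (simp add: sum_divide_distrib)
  then show ?thesis by (simp add: savings_ratio_def)
qed

lemma savings_value_Suc:
  assumes "olg_economy E" "p \<in> equilibria E \<sigma>"
  shows "savings_value E p (Suc t) = savings_value E p t"
proof -
  have p: "p \<in> pos_vecs E UNIV" and
    z: "\<And>i. i \<in> {1..goods E (Suc t)} \<Longrightarrow> excess_demand E (Suc t) p i = 0"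
    using assms(2) by (auto simp: equilibria_def)
  \<comment> \<open>What generation \<open>t\<close> spends in old age beyond the value of its
    endowment there.\<close>
  define dissaving where "dissaving =
    (\<Sum>i\<in>{1..goods E (Suc t)}. \<Sum>h\<in>born E t.
       p (Suc t) i * (demand E t h p (Suc t) i - endow E h (Suc t) i))"
  have "(\<Sum>h\<in>born E t. \<Sum>s\<in>{t, t + 1}. \<Sum>i\<in>{1..goods E s}.
      p s i * (demand E t h p s i - endow E h s i)) = 0"
    using walras_law[OF assms(1) _ p] by simp
  then have "(\<Sum>h\<in>born E t. \<Sum>i\<in>{1..goods E t}. p t i * (demand E t h p t i - endow E h t i)) +
      (\<Sum>h\<in>born E t. \<Sum>i\<in>{1..goods E (Suc t)}.
         p (Suc t) i * (demand E t h p (Suc t) i - endow E h (Suc t) i)) = 0"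
    by (simp add: sum.distrib)
  then have "dissaving = savings_value E p t"
    unfolding dissaving_def savings_value_def
    by (simp add: sum.swap[of _ _ "born E t"] algebra_simps sum_subtractf)
  \<comment> \<open>The value of excess demand is the net spending of the old minus the savings of
    the young, so market clearing equates the two.\<close>
  moreover have "dissaving - savings_value E p (Suc t) =
      (\<Sum>i\<in>{1..goods E (Suc t)}. p (Suc t) i * excess_demand E (Suc t) p i)"
    by (simp add: dissaving_def savings_value_def excess_demand_def sum_subtractf sum.distrib
        sum_distrib_left algebra_simps)
  ultimately show ?thesis using z by simp
qed

lemma savings_value_const:
  assumes "olg_economy E" "p \<in> equilibria E \<sigma>"
  shows "savings_value E p t = savings_value E p 0"
  by (induction t) (simp_all add: savings_value_Suc[OF assms])

section \<open>Equilibrium prices stay away from the border\<close>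

lemma equilibrium_feasible:
  assumes "olg_economy E" "p \<in> equilibria E \<sigma>"
  shows "(\<Sum>h\<in>born E t. norm1 E {Suc t} (demand E t h p)) +
      (\<Sum>h\<in>born E (Suc t). norm1 E {Suc t} (demand E (Suc t) h p)) =
    old_endow E t + young_endow E (Suc t)"
proof -
  have p: "p \<in> pos_vecs E UNIV" and
    z: "\<And>i. i \<in> {1..goods E (Suc t)} \<Longrightarrow> excess_demand E (Suc t) p i = 0"
    using assms(2) by (auto simp: equilibria_def)
  have "(\<Sum>i\<in>{1..goods E (Suc t)}. excess_demand E (Suc t) p i) = 0"
    using z by simp
  then have "(\<Sum>i\<in>{1..goods E (Suc t)}. \<Sum>h\<in>born E t. demand E t h p (Suc t) i) +
      (\<Sum>i\<in>{1..goods E (Suc t)}. \<Sum>h\<in>born E (Suc t). demand E (Suc t) h p (Suc t) i) =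
      (\<Sum>i\<in>{1..goods E (Suc t)}. \<Sum>h\<in>born E t. endow E h (Suc t) i) +
      (\<Sum>i\<in>{1..goods E (Suc t)}. \<Sum>h\<in>born E (Suc t). endow E h (Suc t) i)"
    by (simp add: excess_demand_def sum.distrib sum_subtractf)
  then have "(\<Sum>h\<in>born E t. \<Sum>i\<in>{1..goods E (Suc t)}. demand E t h p (Suc t) i) +
      (\<Sum>h\<in>born E (Suc t). \<Sum>i\<in>{1..goods E (Suc t)}. demand E (Suc t) h p (Suc t) i) =
      (\<Sum>h\<in>born E t. \<Sum>i\<in>{1..goods E (Suc t)}. endow E h (Suc t) i) +
      (\<Sum>h\<in>born E (Suc t). \<Sum>i\<in>{1..goods E (Suc t)}. endow E h (Suc t) i)"
    by (simp only: sum.swap[where A = "{1..goods E (Suc t)}"])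
  \<comment> \<open>Demands and endowments are nonnegative, so the plain sums are norms.\<close>
  then show ?thesis
    by (simp add: norm1_def old_endow_def young_endow_def
        demand_nonneg[OF assms(1) _ p] endow_nonneg[OF assms(1)])
qed

text \<open>Outside the box, generation \<open>t\<close> would demand more than \<open>beta\<close>
  times its endowment. Market clearing in \<open>t\<close> and \<open>t + 1\<close> caps its demand
  by the total endowments of these periods, which bounded growth keeps below that multiple. The case
  \<open>t = 0\<close> is excluded because market clearing is imposed only from period 1 on.\<close>

lemma equilibrium_price_in_box:
  assumes "olg_economy E" "bounded_growth E a b" "unbounded_demand E a b \<sigma>" "p \<in> equilibria E \<sigma>"
    and "t \<ge> 1"
  shows "normalize_price t (window t p) \<in> box E t (\<sigma> t)"
proof (rule ccontr)
  obtain r where t: "t = Suc r"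
    using \<open>t \<ge> 1\<close> by (cases t) auto
  note bg = bounded_growth_bounds[OF assms(2)]
  have p: "p \<in> pos_vecs E UNIV"
    using assms(4) by (auto simp: equilibria_def)
  define D where "D t s = (\<Sum>h\<in>born E t. norm1 E {s} (demand E t h p))" for t s
  have D_nonneg: "D t s \<ge> 0" for t s
    by (simp add: D_def sum_nonneg norm1_nonneg)
  have feasible: "D t (Suc t) + D (Suc t) (Suc t) = old_endow E t + young_endow E (Suc t)" for t
    using equilibrium_feasible[OF assms(1,4)] by (simp add: D_def)
  assume "\<not> ?thesis"
  then have "beta a b * (\<Sum>h\<in>born E t. norm1 E {t, t + 1} (endow E h)) <
      (\<Sum>h\<in>born E t. norm1 E {t, t + 1} (demand E t h (window t p)))"
    using assms(3) window_pos_vecs[OF p, of t] unfolding unbounded_demand_def by blast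
  then have "beta a b * (young_endow E t + old_endow E t) < D t t + D t (Suc t)"
    unfolding norm1_two_periods
    by (simp add: demand_window sum.distrib D_def young_endow_def old_endow_def)
  \<comment> \<open>Drops the consumption of the old in \<open>t\<close> and of the young in
    \<open>t + 1\<close>.\<close>
  also have "\<dots> \<le> (old_endow E r + young_endow E t) + (old_endow E t + young_endow E (Suc t))"
    using feasible[of r] feasible[of t] D_nonneg[of r t] D_nonneg[of "Suc t" "Suc t"]
    by (simp add: t)
  \<comment> \<open>The neighbouring generations' endowments are bounded by those of generation
    \<open>t\<close> in the same period; \<open>beta\<close> is the maximum of the two resulting
    factors.\<close>
  also have "\<dots> \<le> (1 + inverse a) * young_endow E t + (1 + b) * old_endow E t"
    using bg(3)[of r] bg(4)[of t] by (simp add: t algebra_simps)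
  also have "\<dots> \<le> beta a b * young_endow E t + beta a b * old_endow E t"
    by (intro add_mono mult_right_mono young_endow_nonneg old_endow_nonneg)
      (auto simp: beta_def)
  finally show False by (simp add: algebra_simps)
qed

section \<open>Convergence of the Cass series and the equivalence\<close>

text \<open>The partial sums increase: if they do not diverge to infinity, they lie below some
  \<open>B\<close> infinitely often and hence always.\<close>

lemma not_filterlim_at_top_iff_summable:
  fixes f :: "nat \<Rightarrow> real"
  assumes "\<And>n. f n \<ge> 0"
  shows "\<not> filterlim (\<lambda>n. \<Sum>t\<le>n. f t) at_top sequentially \<longleftrightarrow> summable f"
proof
  assume "summable f"
  then have "(\<lambda>n. \<Sum>t\<le>n. f t) \<longlonglongrightarrow> suminf f"
    by (rule summable_LIMSEQ')
  then show "\<not> filterlim (\<lambda>n. \<Sum>t\<le>n. f t) at_top sequentially"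
    using not_tendsto_and_filterlim_at_infinity[OF sequentially_bot _ filterlim_at_top_imp_at_infinity]
    by blast
next
  assume "\<not> filterlim (\<lambda>n. \<Sum>t\<le>n. f t) at_top sequentially"
  then obtain B where B: "\<exists>\<^sub>F n in sequentially. (\<Sum>t\<le>n. f t) < B"
    by (auto simp: filterlim_at_top not_eventually not_le)
  show "summable f"
  proof (rule bounded_imp_summable)
    fix n
    obtain m where "m \<ge> n" "(\<Sum>t\<le>m. f t) < B"
      using B by (auto simp: frequently_sequentially)
    moreover have "(\<Sum>t\<le>n. f t) \<le> (\<Sum>t\<le>m. f t)"
      using \<open>m \<ge> n\<close> assms by (intro sum_mono2) auto
    ultimately show "(\<Sum>t\<le>n. f t) \<le> B" by linarith
  qed (use assms in auto)
qed

theorem proposition4: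
  fixes E :: economy and \<alpha>min \<alpha>max :: real and \<sigma> :: "nat \<Rightarrow> real" and p :: vec
  assumes "olg_economy E"
    and "bounded_growth E \<alpha>min \<alpha>max"
    and "unbounded_demand E \<alpha>min \<alpha>max \<sigma>"
    and "generalized_cass E \<sigma>"
    and "prone_to_savings E \<sigma>"
    and "p \<in> equilibria E \<sigma>"
  shows "p \<notin> po_equilibria E \<sigma> \<longleftrightarrow> (\<lambda>t. savings_ratio E t p) \<longlonglongrightarrow> 0"
proof -
  note bg = bounded_growth_bounds[OF assms(2)]
  have p: "p \<in> pos_vecs E UNIV"
    using assms(6) by (auto simp: equilibria_def)
  note norm_pos = norm1_price_pos[OF assms(1) p]
  define f where "f t = 1 / (norm1 E {t} p * young_endow E t)" for t
  have f_nonneg: "f t \<ge> 0" for t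
    by (simp add: f_def norm1_nonneg young_endow_nonneg)
  have ratio: "savings_ratio E t p = savings_value E p 0 * f t" for t
    unfolding savings_ratio_eq f_def savings_value_const[OF assms(1,6), of t] ..
  have "p \<notin> po_equilibria E \<sigma> \<longleftrightarrow> summable f"
    using assms(4,6) not_filterlim_at_top_iff_summable[of f, OF f_nonneg]
    unfolding generalized_cass_def f_def by blast
  also have "\<dots> \<longleftrightarrow> (\<lambda>t. savings_ratio E t p) \<longlonglongrightarrow> 0"
  proof
    assume "summable f"
    then show "(\<lambda>t. savings_ratio E t p) \<longlonglongrightarrow> 0"
      unfolding ratio by (intro tendsto_mult_right_zero summable_LIMSEQ_zero)
  next
    assume lim: "(\<lambda>t. savings_ratio E t p) \<longlonglongrightarrow> 0"
    obtain \<epsilon> \<delta> where "\<epsilon> > 0" "\<delta> > 0" and prone: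
      "\<And>t q. q \<in> pos_vecs E {t, t + 1} \<Longrightarrow> normalize_price t q \<in> box E t (\<sigma> t) \<Longrightarrow>
         savings_ratio E t q \<le> \<delta> \<Longrightarrow>
         norm1 E {t} q / norm1 E {t + 1} q
           \<le> 1 / (1 + \<epsilon>) * (young_endow E (t + 1) / young_endow E t)"
      using assms(5) unfolding prone_to_savings_def by blast
    obtain N where N: "\<And>t. t \<ge> N \<Longrightarrow> savings_ratio E t p < \<delta>"
      using order_tendstoD(2)[OF lim \<open>\<delta> > 0\<close>] by (auto simp: eventually_sequentially)
    show "summable f"
    proof (rule summable_ratio_test)
      show "1 / (1 + \<epsilon>) < 1" using \<open>\<epsilon> > 0\<close> by simp
    next
      \<comment> \<open>From \<open>N\<close> on the savings ratio is below \<open>\<delta>\<close>;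
        from 1 on prices are known to lie in the box and \<open>young_endow E t\<close> to be
        positive.\<close>
      fix t assume t: "max N 1 \<le> t"
      have growth: "norm1 E {t} p / norm1 E {Suc t} p
          \<le> 1 / (1 + \<epsilon>) * (young_endow E (Suc t) / young_endow E t)"
        using prone[OF window_pos_vecs[OF p] equilibrium_price_in_box[OF assms(1-3,6)], of t]
          N[of t] t by (simp add: norm1_window[unfolded Suc_eq_plus1[symmetric]] savings_ratio_window)
      have pos: "young_endow E t > 0" "young_endow E (Suc t) > 0"
        using bg(2)[of "t - 1"] bg(2)[of t] t by simp_all
      \<comment> \<open>Isolates the price ratio that proneness to savings bounds; the endowment
        ratio in that bound then replaces \<open>young_endow E (Suc t)\<close> by
        \<open>young_endow E t\<close>, which gives back \<open>f t\<close>.\<close>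
      have "f (Suc t) =
          norm1 E {t} p / norm1 E {Suc t} p * (1 / (norm1 E {t} p * young_endow E (Suc t)))"
        using norm_pos[of t] by (simp add: f_def)
      also have "\<dots> \<le> 1 / (1 + \<epsilon>) * (young_endow E (Suc t) / young_endow E t) *
          (1 / (norm1 E {t} p * young_endow E (Suc t)))"
        using norm_pos[of t] pos by (intro mult_right_mono[OF growth]) simp
      also have "\<dots> = 1 / (1 + \<epsilon>) * f t"
        using pos by (simp add: f_def)
      finally have "f (Suc t) \<le> 1 / (1 + \<epsilon>) * f t" .
      then show "norm (f (Suc t)) \<le> 1 / (1 + \<epsilon>) * norm (f t)"
        using f_nonneg by simp
    qed
  qed
  finally show ?thesis .
qed

end
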